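(* Let $\mathcal{Y}=\langle\Sigma,\mathcal{N},Z,V,S,W,\delta,\lambda\rangle$ be a non-deterministic finite automaton generator of context-free languages (as defined in the context). Then the language $L(\mathcal{Y})$ generated by $\mathcal{Y}$ is a context-free language.
   Context: $\Sigma^*$ is the free monoid of words over $\Sigma$ with identity the empty word $\varepsilon$, and $\Sigma^+=\Sigma^*\setminus\{\varepsilon\}$. $\mathcal{P}(M)$ denotes the set of all subsets of a set $M$. A language over $\Sigma$ is context-free if it is generated by a context-free grammar with terminal alphabet $\Sigma$ from some start symbol, in the standard sense. The monoid $W$ for given finite sets $\Sigma$, $\mathcal{N}$. Let $\mathcal{N}'=\{A'\mid A\in\mathcal{N}\}$ be a disjoint copy of $\mathcal{N}$ ($\mathcal{N}\cap\mathcal{N}'=\emptyset$). Let $T$ be the monoid with set of generators $\mathcal{N}\cup\mathcal{N}'$ and defining relations $AA'=\varepsilon$ for all $A\in\mathcal{N}$, where $\varepsilon$ also denotes the identity of $T$. Let $W=\Sigma^*\times T=\{\langle\alpha,\omega\rangle\mid\alpha\in\Sigma^*,\ \omega\in T\}$ with product $\langle\alpha_1,\omega_1\rangle\circ\langle\alpha_2,\omega_2\rangle=\langle\alpha_1\alpha_2,\omega_1\omega_2\rangle$ and identity $\langle\varepsilon,\varepsilon\rangle$. A non-deterministic finite automaton generator of context-free languages is an 8-tuple $\mathcal{Y}=\langle\Sigma,\mathcal{N},Z,V,S,W,\delta,\lambda\rangle$ where: $\Sigma$ is a finite set of terminal symbols; $\mathcal{N}$ is a finite set of nonterminal symbols,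 disjoint from $\Sigma$; $Z\notin\mathcal{N}\cup\Sigma$ is a special symbol called the final state; $V=\mathcal{N}\cup\{Z\}$ is the set of states; $S\in\mathcal{N}$ is the start state; $W$ is the monoid above; $\delta:V\to\mathcal{P}(V)$ is the transition function; $\lambda$ is the output (labeling) function, which assigns to each pair $(A,B)\in V\times V$ with $B\in\delta(A)$ (and only to such pairs) a set $\lambda(A,B)\in\mathcal{P}(W)$. These satisfy: 1. $Z\in\delta(A)$ if and only if $A\in\mathcal{N}$ and there exists $a\in\Sigma$ with $\langle a,\varepsilon\rangle\in\lambda(A,Z)$. 2. For every $C\in\mathcal{N}$: there exist $A,B\in\mathcal{N}$ with $B\in\delta(A)$ and $\langle\varepsilon,C\rangle\in\lambda(A,B)$ if and only if $C\in\delta(Z)$ and $\langle\varepsilon,C'\rangle\in\lambda(Z,C)$. 3. There are no transitions or labels other than those described in 1 and 2: for $A,B,C\in\mathcal{N}$, every element of $\lambda(A,Z)$ (when $Z\in\delta(A)$) has the form $\langle a,\varepsilon\rangle$ with $a\in\Sigma$; every element of $\lambda(A,B)$ (when $B\in\delta(A)$) has the form $\langle\varepsilon,D\rangle$ with $D\in\mathcal{N}$; the only possible element of $\lambda(Z,C)$ (when $C\in\delta(Z)$) is $\langle\varepsilon,C'\rangle$; and $Z\notin\delta(Z)$. A word $\alpha\in\Sigma^+$ is generated by $\mathcal{Y}$ if there exist a positive integer $k$ and sequences $A_0,A_1,\ldots,A_k$ in $V$ and $w_1,\ldots,w_k$ in $W$ such that $A_0=S$, $A_k=Z$, $A_i\in\delta(A_{i-1})$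 and $w_i\in\lambda(A_{i-1},A_i)$ for $i=1,\ldots,k$, and $w_1\circ w_2\circ\cdots\circ w_k=\langle\alpha,\varepsilon\rangle$. The language $L(\mathcal{Y})$ generated by $\mathcal{Y}$ is the set of all words $\alpha\in\Sigma^+$ generated by $\mathcal{Y}$. *)

theory Defs
  imports "HOL-Algebra.Group"
begin

datatype ('n, 't) sym = Nt 'n | Tm 't

record ('n, 't) cfg =
  cfg_terms :: "'t set"
  cfg_nonterms :: "'n set"
  cfg_prods :: "('n \<times> ('n, 't) sym list) set"
  cfg_start :: 'n

definition is_cfg :: "('n, 't) cfg \<Rightarrow> bool" where
  "is_cfg G \<longleftrightarrow>
     finite (cfg_terms G) \<and> finite (cfg_nonterms G) \<and> finite (cfg_prods G) \<and>
     cfg_prods G \<subseteq> cfg_nonterms G \<times> lists (Nt ` cfg_nonterms G \<union> Tm ` cfg_terms G) \<and>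
     cfg_start G \<in> cfg_nonterms G"

definition derives1 :: "('n, 't) cfg \<Rightarrow> (('n, 't) sym list \<times> ('n, 't) sym list) set" where
  "derives1 G = {(u @ [Nt A] @ v, u @ w @ v) | u v A w. (A, w) \<in> cfg_prods G}"

definition cfg_lang :: "('n, 't) cfg \<Rightarrow> 't list set" where
  "cfg_lang G = {w \<in> lists (cfg_terms G). ([Nt (cfg_start G)], map Tm w) \<in> (derives1 G)\<^sup>*}"

text \<open>
  A grammar has finitely many nonterminals, so up to renaming they are natural numbers; this
  avoids a type parameter for nonterminals in the notion of a context-free language.
\<close>

definition context_free :: "'t set \<Rightarrow> 't list set \<Rightarrow> bool" where
  "context_free \<Sigma> L \<longleftrightarrow>
     (\<exists>G :: (nat, 't) cfg. is_cfg G \<and> cfg_terms G = \<Sigma> \<and> cfg_lang G = L)"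

definition free_monoid :: "'a set \<Rightarrow> 'a list monoid" where
  "free_monoid X = \<lparr>carrier = lists X, mult = (@), one = []\<rparr>"

inductive_set mcong :: "'g set \<Rightarrow> ('g list \<times> 'g list) set \<Rightarrow> ('g list \<times> 'g list) set"
  for X :: "'g set" and R :: "('g list \<times> 'g list) set" where
  rel: "(u, v) \<in> R \<Longrightarrow> u \<in> lists X \<Longrightarrow> v \<in> lists X \<Longrightarrow> (u, v) \<in> mcong X R"
| refl: "u \<in> lists X \<Longrightarrow> (u, u) \<in> mcong X R"
| sym: "(u, v) \<in> mcong X R \<Longrightarrow> (v, u) \<in> mcong X R"
| trans: "(u, v) \<in> mcong X R \<Longrightarrow> (v, w) \<in> mcong X R \<Longrightarrow> (u, w) \<in> mcong X R"
| append: "(u, v) \<in> mcong X R \<Longrightarrow> (u', v') \<in> mcong X R \<Longrightarrow> (u @ u', v @ v') \<in> mcong X R"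

definition presented_monoid :: "'g set \<Rightarrow> ('g list \<times> 'g list) set \<Rightarrow> 'g list set monoid" where
  "presented_monoid X R =
     \<lparr>carrier = lists X // mcong X R,
      mult = (\<lambda>P Q. mcong X R `` {p @ q | p q. p \<in> P \<and> q \<in> Q}),
      one = mcong X R `` {[]}\<rparr>"

lemma mcong_lists: "(u, v) \<in> mcong X R \<Longrightarrow> u \<in> lists X \<and> v \<in> lists X"
  by (induction rule: mcong.induct) auto

lemma equiv_mcong: "equiv (lists X) (mcong X R)"
proof (rule equivI)
  show "mcong X R \<subseteq> lists X \<times> lists X" using mcong_lists by fastforce
  show "refl_on (lists X) (mcong X R)" by (auto intro!: refl_onI mcong.refl)
  show "Relation.sym (mcong X R)" by (auto intro: symI mcong.sym)
  show "Relation.trans (mcong X R)" by (auto intro: transI mcong.trans)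
qed

lemma presented_mult:
  assumes "u \<in> lists X" "v \<in> lists X"
  shows "mcong X R `` {u} \<otimes>\<^bsub>presented_monoid X R\<^esub> mcong X R `` {v} = mcong X R `` {u @ v}"
proof -
  let ?r = "mcong X R"
  have "(u @ v, w) \<in> ?r" if "(u, p) \<in> ?r" "(v, q) \<in> ?r" "(p @ q, w) \<in> ?r" for p q w
    by (rule mcong.trans[OF mcong.append[OF that(1,2)] that(3)])
  moreover have "(u, u) \<in> ?r" "(v, v) \<in> ?r"
    using assms by (simp_all add: mcong.refl)
  ultimately show ?thesis
    unfolding presented_monoid_def by (simp add: set_eq_iff Image_iff) blast
qed

lemma monoid_presented: "monoid (presented_monoid X R)"
proof -
  let ?M = "presented_monoid X R" and ?c = "\<lambda>u. mcong X R `` {u}"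
  have rep: "\<exists>u\<in>lists X. P = ?c u" if "P \<in> carrier ?M" for P
    using that by (auto simp: presented_monoid_def elim!: quotientE)
  have cl: "?c u \<in> carrier ?M" if "u \<in> lists X" for u
    using that unfolding presented_monoid_def by (auto intro!: quotientI)
  have one: "\<one>\<^bsub>?M\<^esub> = ?c []" by (simp add: presented_monoid_def)
  note m = presented_mult[where X = X and R = R]
  show ?thesis
  proof (rule monoidI)
    show "\<one>\<^bsub>?M\<^esub> \<in> carrier ?M" unfolding one by (rule cl) simp
  next
    fix P Q assume "P \<in> carrier ?M" "Q \<in> carrier ?M"
    then obtain u v where uv: "u \<in> lists X" "v \<in> lists X" and PQ: "P = ?c u" "Q = ?c v"
      using rep by meson
    from uv have "u @ v \<in> lists X" by simp
    then show "P \<otimes>\<^bsub>?M\<^esub> Q \<in> carrier ?M" unfolding PQ m[OF uv] by (rule cl)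
  next
    fix P Q S assume "P \<in> carrier ?M" "Q \<in> carrier ?M" "S \<in> carrier ?M"
    then obtain u v w where uvw: "u \<in> lists X" "v \<in> lists X" "w \<in> lists X"
      and PQS: "P = ?c u" "Q = ?c v" "S = ?c w"
      using rep by meson
    from uvw have l: "u @ v \<in> lists X" "v @ w \<in> lists X" by simp_all
    show "P \<otimes>\<^bsub>?M\<^esub> Q \<otimes>\<^bsub>?M\<^esub> S = P \<otimes>\<^bsub>?M\<^esub> (Q \<otimes>\<^bsub>?M\<^esub> S)"
      unfolding PQS m[OF uvw(1,2)] m[OF uvw(2,3)] m[OF l(1) uvw(3)] m[OF uvw(1) l(2)] by simp
  next
    fix P assume "P \<in> carrier ?M"
    then obtain u where u: "u \<in> lists X" "P = ?c u" using rep by meson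
    have "[] \<in> lists X" by simp
    then show "\<one>\<^bsub>?M\<^esub> \<otimes>\<^bsub>?M\<^esub> P = P" "P \<otimes>\<^bsub>?M\<^esub> \<one>\<^bsub>?M\<^esub> = P"
      unfolding one u(2) using m[OF \<open>[] \<in> lists X\<close> u(1)] m[OF u(1) \<open>[] \<in> lists X\<close>]
      by (simp_all only: append_Nil append_Nil2)
  qed
qed

lemma monoid_free: "monoid (free_monoid X)"
  by (rule monoidI) (auto simp: free_monoid_def)

text \<open>
  \<open>Plain A\<close> is the generator \<open>A\<close> and \<open>Primed A\<close> is \<open>A'\<close>.
  The empty product is \<open>\<one>\<close>, written \<open>\<epsilon>\<close> on paper.
\<close>

datatype 'a tgen = Plain 'a | Primed 'a

definition T_gens :: "'a set \<Rightarrow> 'a tgen set" where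
  "T_gens N = Plain ` N \<union> Primed ` N"

definition T_rels :: "'a set \<Rightarrow> ('a tgen list \<times> 'a tgen list) set" where
  "T_rels N = {([Plain A, Primed A], []) | A. A \<in> N}"

definition T_monoid :: "'a set \<Rightarrow> 'a tgen list set monoid" where
  "T_monoid N = presented_monoid (T_gens N) (T_rels N)"

definition T_class :: "'a set \<Rightarrow> 'a tgen list \<Rightarrow> 'a tgen list set" where
  "T_class N u = mcong (T_gens N) (T_rels N) `` {u}"

definition W_monoid :: "'a set \<Rightarrow> 'a set \<Rightarrow> ('a list \<times> 'a tgen list set) monoid" where
  "W_monoid \<Sigma> N = free_monoid \<Sigma> \<times>\<times> T_monoid N"

lemma monoid_W: "monoid (W_monoid \<Sigma> N)"
  unfolding W_monoid_def T_monoid_def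
  by (intro DirProd_monoid monoid_free monoid_presented)

text \<open>
  The components \<open>V\<close> and \<open>W\<close> of the 8-tuple are determined by the others, hence definitions
  rather than fields. The labeling is a partial function on pairs of states with domain
  exactly the transitions, so \<open>has_label\<close> presupposes that the transition exists.
\<close>

record 'a cf_generator =
  terminals :: "'a set"
  nonterminals :: "'a set"
  final_state :: 'a
  start_state :: 'a
  transition :: "'a \<Rightarrow> 'a set"
  labeling :: "'a \<times> 'a \<rightharpoonup> ('a list \<times> 'a tgen list set) set"

definition states :: "'a cf_generator \<Rightarrow> 'a set" where
  "states Y = nonterminals Y \<union> {final_state Y}"

definition output_monoid :: "'a cf_generator \<Rightarrow> ('a list \<times> 'a tgen list set) monoid" where
  "output_monoid Y = W_monoid (terminals Y) (nonterminals Y)"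

definition has_label ::
  "'a cf_generator \<Rightarrow> 'a \<Rightarrow> 'a \<Rightarrow> 'a list \<times> 'a tgen list set \<Rightarrow> bool" where
  "has_label Y A B w \<longleftrightarrow> (\<exists>X. labeling Y (A, B) = Some X \<and> w \<in> X)"

definition letter_label :: "'a cf_generator \<Rightarrow> 'a \<Rightarrow> 'a list \<times> 'a tgen list set" where
  "letter_label Y a = ([a], \<one>\<^bsub>T_monoid (nonterminals Y)\<^esub>)"

definition plain_label :: "'a cf_generator \<Rightarrow> 'a \<Rightarrow> 'a list \<times> 'a tgen list set" where
  "plain_label Y C = ([], T_class (nonterminals Y) [Plain C])"

definition primed_label :: "'a cf_generator \<Rightarrow> 'a \<Rightarrow> 'a list \<times> 'a tgen list set" where
  "primed_label Y C = ([], T_class (nonterminals Y) [Primed C])"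

definition is_cf_generator :: "'a cf_generator \<Rightarrow> bool" where
  "is_cf_generator Y \<longleftrightarrow>
     (let \<Sigma> = terminals Y; N = nonterminals Y; Z = final_state Y; V = states Y;
          \<delta> = transition Y
      in
        finite \<Sigma> \<and> finite N \<and> N \<inter> \<Sigma> = {} \<and> Z \<notin> N \<union> \<Sigma> \<and> start_state Y \<in> N \<and>
        (\<forall>A\<in>V. \<delta> A \<subseteq> V) \<and>
        dom (labeling Y) = {(A, B). A \<in> V \<and> B \<in> V \<and> B \<in> \<delta> A} \<and>
        ran (labeling Y) \<subseteq> Pow (carrier (output_monoid Y)) \<and>
        (\<forall>A\<in>V. Z \<in> \<delta> A \<longleftrightarrow> A \<in> N \<and> (\<exists>a\<in>\<Sigma>. has_label Y A Z (letter_label Y a))) \<and>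
        (\<forall>C\<in>N. (\<exists>A\<in>N. \<exists>B\<in>N. B \<in> \<delta> A \<and> has_label Y A B (plain_label Y C)) \<longleftrightarrow>
                C \<in> \<delta> Z \<and> has_label Y Z C (primed_label Y C)) \<and>
        (\<forall>A\<in>N. \<forall>w. has_label Y A Z w \<longrightarrow> (\<exists>a\<in>\<Sigma>. w = letter_label Y a)) \<and>
        (\<forall>A\<in>N. \<forall>B\<in>N. \<forall>w. has_label Y A B w \<longrightarrow> (\<exists>D\<in>N. w = plain_label Y D)) \<and>
        (\<forall>C\<in>N. \<forall>w. has_label Y Z C w \<longrightarrow> w = primed_label Y C) \<and>
        Z \<notin> \<delta> Z)"

definition generated :: "'a cf_generator \<Rightarrow> 'a list \<Rightarrow> bool" where
  "generated Y \<alpha> \<longleftrightarrow>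
     (\<exists>k A w. 0 < k \<and> (\<forall>i\<le>k. A i \<in> states Y) \<and>
        (\<forall>i\<in>{1..k}. w i \<in> carrier (output_monoid Y)) \<and>
        A 0 = start_state Y \<and> A k = final_state Y \<and>
        (\<forall>i\<in>{1..k}. A i \<in> transition Y (A (i - 1)) \<and> has_label Y (A (i - 1)) (A i) (w i)) \<and>
        foldr (\<otimes>\<^bsub>output_monoid Y\<^esub>) (map w [1..<Suc k]) \<one>\<^bsub>output_monoid Y\<^esub>
          = (\<alpha>, \<one>\<^bsub>T_monoid (nonterminals Y)\<^esub>))"

definition generator_lang :: "'a cf_generator \<Rightarrow> 'a list set" where
  "generator_lang Y = {\<alpha> \<in> lists (terminals Y) - {[]}. generated Y \<alpha>}"

end

theory Submission
  imports Defs
begin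

text \<open>
  The generator is a pushdown automaton in disguise: a move between nonterminals labelled \<open>D\<close>
  pushes \<open>D\<close>, a move to \<open>Z\<close> emits a letter, and a move from \<open>Z\<close> to \<open>C\<close> pops \<open>C\<close>.  Since \<open>T\<close> acts on
  stacks by partial maps, a walk whose label is \<open>\<epsilon>\<close> in \<open>T\<close> starts and ends with the empty stack.  A
  walk from \<open>A\<close> to \<open>Z\<close> of this kind either emits one letter or pushes some \<open>D\<close> on entering \<open>B\<close>, goes
  on from \<open>B\<close> to \<open>Z\<close>, pops \<open>D\<close>, and goes on from \<open>D\<close> to \<open>Z\<close>.  So the grammar with productions
  \<open>A \<rightarrow> a\<close> and \<open>A \<rightarrow> B D\<close> generates the language.  Condition 2 of the definition guarantees that
  the symbol \<open>D\<close> in the second kind of production can be popped.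
\<close>

section \<open>Derivations in context-free grammars\<close>

lemma derives1_append:
  assumes "(u, v) \<in> derives1 G"
  shows "(x @ u @ y, x @ v @ y) \<in> derives1 G"
proof -
  obtain p A q w where "u = p @ [Nt A] @ q" "v = p @ w @ q" "(A, w) \<in> cfg_prods G"
    using assms unfolding derives1_def by blast
  then have "x @ u @ y = (x @ p) @ [Nt A] @ (q @ y)" "x @ v @ y = (x @ p) @ w @ (q @ y)"
    "(A, w) \<in> cfg_prods G" by simp_all
  then show ?thesis unfolding derives1_def by blast
qed

lemma derives_append:
  "(u, v) \<in> (derives1 G)\<^sup>* \<Longrightarrow> (x @ u @ y, x @ v @ y) \<in> (derives1 G)\<^sup>*"
  by (induction rule: rtrancl_induct) (auto intro: rtrancl_into_rtrancl derives1_append)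

lemma derives_prod:
  "(A, w) \<in> cfg_prods G \<Longrightarrow> (Nt A # y, w @ y) \<in> (derives1 G)\<^sup>*"
  unfolding derives1_def by (rule r_into_rtrancl) force

text \<open>Reads a sentential form as a concatenation of languages, a nonterminal \<open>A\<close>
  standing for the language \<open>R A\<close>.\<close>

primrec yields :: "('n \<Rightarrow> 't list \<Rightarrow> bool) \<Rightarrow> ('n, 't) sym list \<Rightarrow> 't list \<Rightarrow> bool" where
  "yields R [] \<alpha> \<longleftrightarrow> \<alpha> = []"
| "yields R (x # xs) \<alpha> \<longleftrightarrow>
     (\<exists>\<beta> \<gamma>. \<alpha> = \<beta> @ \<gamma> \<and> (case x of Nt A \<Rightarrow> R A \<beta> | Tm a \<Rightarrow> \<beta> = [a]) \<and> yields R xs \<gamma>)"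

lemma yields_append:
  "yields R (xs @ ys) \<alpha> \<longleftrightarrow> (\<exists>\<beta> \<gamma>. \<alpha> = \<beta> @ \<gamma> \<and> yields R xs \<beta> \<and> yields R ys \<gamma>)"
proof (induction xs arbitrary: \<alpha>)
  case (Cons x xs)
  show ?case
    unfolding append_Cons yields.simps Cons.IH
    by (smt (verit, best) append.assoc)
qed simp

lemma yields_Tm: "yields R (map Tm \<alpha>) \<alpha>"
  by (induction \<alpha>) auto

text \<open>Induction from the terminal end of the derivation: undoing a production step replaces
  the factor derived from \<open>w\<close> by \<open>A\<close>, and closure of \<open>R\<close>
  under productions keeps the decomposition of \<alpha> valid. To bound the language of a grammar it
  thus suffices to find a closed family of languages.\<close>

lemma derives_yields:
  assumes closed: "\<And>A w \<alpha>. (A, w) \<in> cfg_prods G \<Longrightarrow> yields R w \<alpha> \<Longrightarrow> R A \<alpha>"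
    and "(u, map Tm \<alpha>) \<in> (derives1 G)\<^sup>*"
  shows "yields R u \<alpha>"
  using assms(2)
proof (induction rule: converse_rtrancl_induct)
  case base
  show ?case by (rule yields_Tm)
next
  case (step u v)
  then obtain p A q w where uv: "u = p @ [Nt A] @ q" "v = p @ w @ q" and prod: "(A, w) \<in> cfg_prods G"
    unfolding derives1_def by blast
  from step.IH obtain \<beta> \<gamma> \<eta> where "\<alpha> = \<beta> @ \<gamma> @ \<eta>" "yields R p \<beta>" "yields R w \<gamma>" "yields R q \<eta>"
    unfolding uv yields_append by blast
  moreover from this have "yields R [Nt A] \<gamma>" using closed[OF prod] by simp
  ultimately show ?case unfolding uv yields_append by blast
qed

section \<open>The monoid \<open>T\<close>\<close>

text \<open>The partial action of generator words on stacks, with the top of the stack at the head;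
  \<open>None\<close> marks a pop from an empty stack or one with another symbol on top.\<close>

fun run_stack :: "'a tgen list \<Rightarrow> 'a list \<Rightarrow> 'a list option" where
  "run_stack [] s = Some s"
| "run_stack (Plain A # u) s = run_stack u (A # s)"
| "run_stack (Primed A # u) s =
     (case s of [] \<Rightarrow> None | B # s' \<Rightarrow> if A = B then run_stack u s' else None)"

lemma run_stack_append: "run_stack (u @ v) s = Option.bind (run_stack u s) (run_stack v)"
  by (induction u s rule: run_stack.induct) (auto split: list.split)

text \<open>Pushing \<open>A\<close> and popping it at once restores any stack, so the defining
  relations hold for these partial maps, and composition carries this over to the congruence. The
  stack stays arbitrary in the induction because in a product the second factor meets a changed
  stack.\<close>

lemma run_stack_mcong:
  "(u, v) \<in> mcong (T_gens N) (T_rels N) \<Longrightarrow> run_stack u s = run_stack v s"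
  by (induction arbitrary: s rule: mcong.induct)
    (auto simp: T_rels_def run_stack_append Option.bind_eq_None_conv split: bind_splits)

lemma T_class_eq_one_iff:
  assumes "u \<in> lists (T_gens N)"
  shows "T_class N u = \<one>\<^bsub>T_monoid N\<^esub> \<longleftrightarrow> (u, []) \<in> mcong (T_gens N) (T_rels N)"
  unfolding T_class_def T_monoid_def presented_monoid_def
  using eq_equiv_class_iff[OF equiv_mcong assms, of "[]" "T_rels N"] by simp

text \<open>The inner word collapses first, which makes the two generators of \<open>D\<close>
  adjacent, and they cancel.\<close>

lemma mcong_bracket:
  assumes "D \<in> N" "(u, []) \<in> mcong (T_gens N) (T_rels N)" "(v, []) \<in> mcong (T_gens N) (T_rels N)"
  shows "(Plain D # u @ Primed D # v, []) \<in> mcong (T_gens N) (T_rels N)"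
proof -
  let ?c = "mcong (T_gens N) (T_rels N)"
  have gens: "Plain D \<in> T_gens N" "Primed D \<in> T_gens N"
    using assms(1) by (auto simp: T_gens_def)
  have "([Plain D] @ u @ [Primed D], [Plain D] @ [] @ [Primed D]) \<in> ?c"
    using gens assms(2) by (intro mcong.append mcong.refl) auto
  moreover have "([Plain D, Primed D], []) \<in> ?c"
    using gens assms(1) by (intro mcong.rel) (auto simp: T_rels_def)
  ultimately have "([Plain D] @ u @ [Primed D], []) \<in> ?c"
    using mcong.trans by fastforce
  from mcong.append[OF this assms(3)] show ?thesis by simp
qed

lemma W_mult:
  assumes "u \<in> lists (T_gens N)" "v \<in> lists (T_gens N)"
  shows "(\<alpha>, T_class N u) \<otimes>\<^bsub>W_monoid \<Sigma> N\<^esub> (\<beta>, T_class N v) = (\<alpha> @ \<beta>, T_class N (u @ v))"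
  using presented_mult[OF assms, of "T_rels N"]
  by (simp add: W_monoid_def T_monoid_def T_class_def free_monoid_def)

lemma T_one: "\<one>\<^bsub>T_monoid N\<^esub> = T_class N []"
  by (simp add: T_monoid_def T_class_def presented_monoid_def)

lemma W_one: "\<one>\<^bsub>W_monoid \<Sigma> N\<^esub> = ([], T_class N [])"
  by (simp add: W_monoid_def T_one free_monoid_def)

section \<open>Walks to the final state\<close>

text \<open>Records the word over the generators instead of its class in \<open>T\<close>, so that
  the stack action can follow it letter by letter. Each rule prepends one move.\<close>

inductive walk :: "'a cf_generator \<Rightarrow> 'a \<Rightarrow> 'a list \<Rightarrow> 'a tgen list \<Rightarrow> bool" for Y where
  stop: "walk Y (final_state Y) [] []"
| emit: "A \<in> nonterminals Y \<Longrightarrow> a \<in> terminals Y \<Longrightarrow> has_label Y A (final_state Y) (letter_label Y a) \<Longrightarrow>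
    walk Y (final_state Y) \<alpha> u \<Longrightarrow> walk Y A (a # \<alpha>) u"
| push: "A \<in> nonterminals Y \<Longrightarrow> B \<in> nonterminals Y \<Longrightarrow> D \<in> nonterminals Y \<Longrightarrow>
    has_label Y A B (plain_label Y D) \<Longrightarrow> walk Y B \<alpha> u \<Longrightarrow> walk Y A \<alpha> (Plain D # u)"
| pop: "C \<in> nonterminals Y \<Longrightarrow> has_label Y (final_state Y) C (primed_label Y C) \<Longrightarrow>
    walk Y C \<alpha> u \<Longrightarrow> walk Y (final_state Y) \<alpha> (Primed C # u)"

text \<open>The second walk takes the place of the \<open>stop\<close> that ends the first.\<close>

lemma walk_append:
  "walk Y A \<alpha> u \<Longrightarrow> walk Y (final_state Y) \<beta> v \<Longrightarrow> walk Y A (\<alpha> @ \<beta>) (u @ v)"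
  by (induction rule: walk.induct) (auto intro: walk.intros)

lemma walk_gens: "walk Y A \<alpha> u \<Longrightarrow> u \<in> lists (T_gens (nonterminals Y))"
  by (induction rule: walk.induct) (auto simp: T_gens_def)

section \<open>The moves of a generator, and walks read off from its runs\<close>

lemma is_cf_generatorD:
  assumes "is_cf_generator Y"
  shows "finite (terminals Y)" "finite (nonterminals Y)"
    "final_state Y \<notin> nonterminals Y \<union> terminals Y" "start_state Y \<in> nonterminals Y"
    "dom (labeling Y) = {(A, B). A \<in> states Y \<and> B \<in> states Y \<and> B \<in> transition Y A}"
    "ran (labeling Y) \<subseteq> Pow (carrier (output_monoid Y))"
    "\<forall>C\<in>nonterminals Y. (\<exists>A\<in>nonterminals Y. \<exists>B\<in>nonterminals Y. B \<in> transition Y A \<and>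
        has_label Y A B (plain_label Y C)) \<longleftrightarrow>
      C \<in> transition Y (final_state Y) \<and> has_label Y (final_state Y) C (primed_label Y C)"
    "\<forall>A\<in>nonterminals Y. \<forall>w. has_label Y A (final_state Y) w \<longrightarrow> (\<exists>a\<in>terminals Y. w = letter_label Y a)"
    "\<forall>A\<in>nonterminals Y. \<forall>B\<in>nonterminals Y. \<forall>w. has_label Y A B w \<longrightarrow>
      (\<exists>D\<in>nonterminals Y. w = plain_label Y D)"
    "\<forall>C\<in>nonterminals Y. \<forall>w. has_label Y (final_state Y) C w \<longrightarrow> w = primed_label Y C"
    "final_state Y \<notin> transition Y (final_state Y)"
  using assms unfolding is_cf_generator_def Let_def by - (elim conjE, assumption)+

lemma has_labelD:
  assumes "is_cf_generator Y" "has_label Y A B w"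
  shows "A \<in> states Y" "B \<in> states Y" "B \<in> transition Y A" "w \<in> carrier (output_monoid Y)"
proof -
  obtain X where X: "labeling Y (A, B) = Some X" "w \<in> X"
    using assms(2) by (auto simp: has_label_def)
  have "(A, B) \<in> dom (labeling Y)" "X \<in> ran (labeling Y)"
    using X(1) by (auto intro: ranI)
  with X(2) is_cf_generatorD(5,6)[OF assms(1)]
  show "A \<in> states Y" "B \<in> states Y" "B \<in> transition Y A" "w \<in> carrier (output_monoid Y)"
    by auto
qed

text \<open>This is where condition 2 enters: a symbol that some move pushes can be popped on
  leaving the final state.\<close>

lemma has_label_primed:
  assumes "is_cf_generator Y" "A \<in> nonterminals Y" "B \<in> nonterminals Y" "D \<in> nonterminals Y"
    "has_label Y A B (plain_label Y D)"
  shows "has_label Y (final_state Y) D (primed_label Y D)"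
  using is_cf_generatorD(7)[OF assms(1)] assms(2-5) has_labelD(3)[OF assms(1,5)] by blast

lemma start_in_final_notin: "is_cf_generator Y \<Longrightarrow> start_state Y \<in> nonterminals Y \<and>
    final_state Y \<notin> nonterminals Y"
  using is_cf_generatorD(3,4) by blast

lemma has_label_cases:
  assumes "is_cf_generator Y" "has_label Y A B w"
  obtains (emit) a where "A \<in> nonterminals Y" "B = final_state Y" "a \<in> terminals Y" "w = letter_label Y a"
  | (push) D where "A \<in> nonterminals Y" "B \<in> nonterminals Y" "D \<in> nonterminals Y" "w = plain_label Y D"
  | (pop) "A = final_state Y" "B \<in> nonterminals Y" "w = primed_label Y B"
proof -
  have "A \<in> nonterminals Y \<or> A = final_state Y" "B \<in> nonterminals Y \<or> B = final_state Y"
    using has_labelD[OF assms] by (auto simp: states_def)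
  then show thesis
    using that assms(2) has_labelD(3)[OF assms] is_cf_generatorD(8-11)[OF assms(1)] by metis
qed

text \<open>The three kinds of moves match the rules \<open>emit\<close>, \<open>push\<close> and
  \<open>pop\<close>; multiplying by the label from the left prepends its letter or its
  generator.\<close>

lemma walk_step:
  assumes gen: "is_cf_generator Y" and lab: "has_label Y A B w" and walk: "walk Y B \<beta> v"
  obtains \<alpha> u where "walk Y A \<alpha> u"
    "w \<otimes>\<^bsub>output_monoid Y\<^esub> (\<beta>, T_class (nonterminals Y) v) = (\<alpha>, T_class (nonterminals Y) u)"
  using gen lab
proof (cases rule: has_label_cases)
  case (emit a)
  then show thesis
    using that[OF walk.emit[of A Y a \<beta> v]] lab walk walk_gens[OF walk]
    by (simp add: letter_label_def T_one output_monoid_def W_mult)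
next
  case (push D)
  then show thesis
    using that[OF walk.push[of A Y B D \<beta> v]] lab walk walk_gens[OF walk]
    by (simp add: plain_label_def T_gens_def output_monoid_def W_mult)
next
  case pop
  then show thesis
    using that[of \<beta> "Primed B # v"] lab walk walk_gens[OF walk] walk.pop[of B Y \<beta> v]
    by (simp add: primed_label_def T_gens_def output_monoid_def W_mult)
qed

lemma generated_imp_walk:
  assumes gen: "is_cf_generator Y" and "generated Y \<alpha>"
  obtains u where "walk Y (start_state Y) \<alpha> u" "(u, []) \<in> mcong (T_gens (nonterminals Y)) (T_rels (nonterminals Y))"
proof -
  let ?M = "output_monoid Y" and ?N = "nonterminals Y"
  obtain k A w where A: "A 0 = start_state Y" "A k = final_state Y"
    and lab: "\<forall>i\<in>{1..k}. has_label Y (A (i - 1)) (A i) (w i)"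
    and prod: "foldr (\<otimes>\<^bsub>?M\<^esub>) (map w [1..<Suc k]) \<one>\<^bsub>?M\<^esub> = (\<alpha>, \<one>\<^bsub>T_monoid ?N\<^esub>)"
    using assms(2) unfolding generated_def by blast
  \<comment> \<open>The run is read backwards from \<open>k\<close>, as the product is nested to the
    right. Label \<open>i\<close> belongs to the move into \<open>A i\<close>, so the labels after
    state \<open>j\<close> begin at \<open>Suc j\<close>.\<close>
  have "\<exists>\<beta> u. walk Y (A j) \<beta> u \<and>
      foldr (\<otimes>\<^bsub>?M\<^esub>) (map w [Suc j..<Suc k]) \<one>\<^bsub>?M\<^esub> = (\<beta>, T_class ?N u)" if "j \<le> k" for j
    using that
  proof (induction rule: inc_induct)
    case base
    show ?case
      using walk.stop[of Y] by (auto simp: A output_monoid_def W_one)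
  next
    case (step j)
    then obtain \<beta> u where "walk Y (A (Suc j)) \<beta> u"
      and fold: "foldr (\<otimes>\<^bsub>?M\<^esub>) (map w [Suc (Suc j)..<Suc k]) \<one>\<^bsub>?M\<^esub> = (\<beta>, T_class ?N u)"
      by blast
    moreover have "has_label Y (A j) (A (Suc j)) (w (Suc j))"
      using lab[rule_format, of "Suc j"] step.hyps by simp
    ultimately obtain \<gamma> v where "walk Y (A j) \<gamma> v"
      "w (Suc j) \<otimes>\<^bsub>?M\<^esub> (\<beta>, T_class ?N u) = (\<gamma>, T_class ?N v)"
      using walk_step[OF gen] by blast
    moreover have "[Suc j..<Suc k] = Suc j # [Suc (Suc j)..<Suc k]"
      using step.hyps by (simp add: upt_conv_Cons del: upt_Suc)
    ultimately show ?case using fold by (auto simp del: upt_Suc)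
  qed
  from this[of 0] obtain u where "walk Y (start_state Y) \<alpha> u" "T_class ?N u = \<one>\<^bsub>T_monoid ?N\<^esub>"
    using prod A by auto
  then show thesis
    using that T_class_eq_one_iff walk_gens by metis
qed

section \<open>Runs read off from walks\<close>

definition labelled_path ::
    "'a cf_generator \<Rightarrow> 'a \<Rightarrow> nat \<Rightarrow> (nat \<Rightarrow> 'a) \<Rightarrow> (nat \<Rightarrow> 'a list \<times> 'a tgen list set) \<Rightarrow> bool" where
  "labelled_path Y P k A w \<longleftrightarrow> A 0 = P \<and> A k = final_state Y \<and>
     (\<forall>i\<in>{1..k}. has_label Y (A (i - 1)) (A i) (w i))"

text \<open>States are indexed from 0 but labels from 1, hence the two different shifts; the label
  at 0 is never read.\<close>

lemma labelled_path_Cons: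
  assumes "has_label Y P Q l" "labelled_path Y Q k A w"
  shows "labelled_path Y P (Suc k) (case_nat P A) (\<lambda>i. if i = 1 then l else w (i - 1))"
  unfolding labelled_path_def
proof (intro conjI ballI)
  fix i assume "i \<in> {1..Suc k}"
  then obtain j where j: "i = Suc j" "j \<le> k" by (cases i) auto
  show "has_label Y (case i - 1 of 0 \<Rightarrow> P | Suc j \<Rightarrow> A j) (case i of 0 \<Rightarrow> P | Suc j \<Rightarrow> A j)
      (if i = 1 then l else w (i - 1))"
    \<comment> \<open>For \<open>j = 0\<close> this is the new first move, otherwise it is move
      \<open>j\<close> of the old path.\<close>
    using assms j by (cases j) (auto simp: labelled_path_def dest!: bspec[of _ _ j])
qed (use assms(2) in \<open>auto simp: labelled_path_def\<close>)

lemma foldr_map_shift: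
  "foldr f (map (\<lambda>i. if i = 1 then l else w (i - 1)) [1..<Suc (Suc k)]) z
    = f l (foldr f (map w [1..<Suc k]) z)"
proof -
  have "map (\<lambda>i. if i = 1 then l else w (i - 1)) [1..<Suc (Suc k)] = l # map w [1..<Suc k]"
    by (rule nth_equalityI) (auto simp: nth_Cons simp del: upt_Suc split: nat.split)
  then show ?thesis by (simp del: upt_Suc)
qed

lemma walk_imp_labelled_path:
  assumes "walk Y P \<alpha> u"
  shows "\<exists>k A w. labelled_path Y P k A w \<and>
    foldr (\<otimes>\<^bsub>output_monoid Y\<^esub>) (map w [1..<Suc k]) \<one>\<^bsub>output_monoid Y\<^esub>
      = (\<alpha>, T_class (nonterminals Y) u)"
proof -
  let ?M = "output_monoid Y" and ?N = "nonterminals Y"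
  let ?goal = "\<lambda>P x. \<exists>k A w. labelled_path Y P k A w \<and>
    foldr (\<otimes>\<^bsub>?M\<^esub>) (map w [1..<Suc k]) \<one>\<^bsub>?M\<^esub> = x"
  have step: "?goal P (l \<otimes>\<^bsub>?M\<^esub> x)" if "has_label Y P Q l" "?goal Q x" for P Q l x
  proof -
    obtain k A w where "labelled_path Y Q k A w" "foldr (\<otimes>\<^bsub>?M\<^esub>) (map w [1..<Suc k]) \<one>\<^bsub>?M\<^esub> = x"
      using \<open>?goal Q x\<close> by blast
    with labelled_path_Cons[OF that(1)] foldr_map_shift[of "(\<otimes>\<^bsub>?M\<^esub>)" l w k "\<one>\<^bsub>?M\<^esub>"]
    show ?thesis by (simp del: upt_Suc) blast
  qed
  show ?thesis
    using assms
  proof (induction rule: walk.induct)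
    case stop
    have "labelled_path Y (final_state Y) 0 (\<lambda>_. final_state Y) w" for w
      by (simp add: labelled_path_def)
    then show ?case by (force simp: output_monoid_def W_one)
  next
    case (emit A a \<alpha> u)
    from step[OF emit(3,5)] walk_gens[OF emit(4)] show ?case
      by (simp add: letter_label_def T_one output_monoid_def W_mult)
  next
    case (push A B D \<alpha> u)
    from step[OF push(4,6)] walk_gens[OF push(5)] push(3) show ?case
      by (simp add: plain_label_def output_monoid_def W_mult T_gens_def)
  next
    case (pop C \<alpha> u)
    from step[OF pop(2,4)] walk_gens[OF pop(3)] pop(1) show ?case
      by (simp add: primed_label_def output_monoid_def W_mult T_gens_def)
  qed
qed

lemma walk_imp_generated:
  assumes gen: "is_cf_generator Y" and walk: "walk Y (start_state Y) \<alpha> u"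
    and "(u, []) \<in> mcong (T_gens (nonterminals Y)) (T_rels (nonterminals Y))"
  shows "generated Y \<alpha>"
proof -
  let ?M = "output_monoid Y" and ?N = "nonterminals Y"
  have one: "T_class ?N u = \<one>\<^bsub>T_monoid ?N\<^esub>"
    using T_class_eq_one_iff[OF walk_gens[OF walk]] assms(3) by simp
  obtain k A w where A: "A 0 = start_state Y" "A k = final_state Y"
    and lab: "\<And>i. i \<in> {1..k} \<Longrightarrow> has_label Y (A (i - 1)) (A i) (w i)"
    and prod: "foldr (\<otimes>\<^bsub>?M\<^esub>) (map w [1..<Suc k]) \<one>\<^bsub>?M\<^esub> = (\<alpha>, \<one>\<^bsub>T_monoid ?N\<^esub>)"
    using walk_imp_labelled_path[OF walk] unfolding labelled_path_def one by blast
  \<comment> \<open>For \<open>k = 0\<close> the start state would be the final state, which is not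
    a nonterminal.\<close>
  have "0 < k" using A start_in_final_notin[OF gen] by (cases k) auto
  moreover have "A i \<in> states Y" if "i \<le> k" for i
  proof (cases i)
    case 0
    then show ?thesis using A start_in_final_notin[OF gen] by (simp add: states_def)
  next
    case (Suc j)
    then show ?thesis using has_labelD(2)[OF gen lab[of i]] that by simp
  qed
  ultimately show ?thesis
    unfolding generated_def using A lab prod has_labelD(3,4)[OF gen lab] by blast
qed

section \<open>The grammar of a generator\<close>

text \<open>The map \<open>f\<close> codes nonterminals by natural numbers, as the definition of a context-free language demands.\<close>

definition generator_cfg :: "('a \<Rightarrow> nat) \<Rightarrow> 'a cf_generator \<Rightarrow> (nat, 'a) cfg" where
  "generator_cfg f Y =
     \<lparr>cfg_terms = terminals Y, cfg_nonterms = f ` nonterminals Y,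
      cfg_prods =
        {(f A, [Tm a]) | A a. A \<in> nonterminals Y \<and> a \<in> terminals Y \<and>
           has_label Y A (final_state Y) (letter_label Y a)} \<union>
        {(f A, [Nt (f B), Nt (f D)]) | A B D. A \<in> nonterminals Y \<and> B \<in> nonterminals Y \<and>
           D \<in> nonterminals Y \<and> has_label Y A B (plain_label Y D)},
      cfg_start = f (start_state Y)\<rparr>"

lemma is_cfg_generator_cfg:
  assumes "is_cf_generator Y"
  shows "is_cfg (generator_cfg f Y)"
proof -
  let ?N = "nonterminals Y"
  have fin: "finite (terminals Y)" "finite ?N"
    using is_cf_generatorD(1,2)[OF assms] .
  have "cfg_prods (generator_cfg f Y) \<subseteq> (\<lambda>(A, a). (f A, [Tm a])) ` (?N \<times> terminals Y) \<union>
      (\<lambda>(A, B, D). (f A, [Nt (f B), Nt (f D)])) ` (?N \<times> ?N \<times> ?N)"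
    unfolding generator_cfg_def by (auto simp: image_iff)
  then have "finite (cfg_prods (generator_cfg f Y))"
    by (rule finite_subset) (use fin in auto)
  with fin start_in_final_notin[OF assms] show ?thesis
    unfolding is_cfg_def by (auto simp: generator_cfg_def)
qed

text \<open>The current nonterminal followed by the stack is the unread part of a leftmost
  derivation; in the final state only the stack remains. The stack \<open>s\<close> is arbitrary so
  that the induction passes through pushes.\<close>

lemma walk_imp_derives:
  assumes gen: "is_cf_generator Y" and "walk Y P \<alpha> u" "run_stack u s = Some []"
  shows "((if P = final_state Y then [] else [Nt (f P)]) @ map (\<lambda>C. Nt (f C)) s, map Tm \<alpha>)
    \<in> (derives1 (generator_cfg f Y))\<^sup>*"
  using assms(2,3)
proof (induction arbitrary: s rule: walk.induct)
  case stop
  then show ?case by simp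
next
  case (emit A a \<alpha> u)
  let ?s = "map (\<lambda>C. Nt (f C)) s"
  have "A \<noteq> final_state Y" using emit.hyps start_in_final_notin[OF gen] by auto
  have "(Nt (f A) # ?s, [Tm a] @ ?s) \<in> (derives1 (generator_cfg f Y))\<^sup>*"
    using emit.hyps by (intro derives_prod) (auto simp: generator_cfg_def)
  also have "([Tm a] @ ?s, [Tm a] @ map Tm \<alpha>) \<in> (derives1 (generator_cfg f Y))\<^sup>*"
    using derives_append[OF emit.IH[OF emit.prems], of "[Tm a]" "[]"] by simp
  finally show ?case using \<open>A \<noteq> final_state Y\<close> by simp
next
  case (push A B D \<alpha> u)
  let ?s = "map (\<lambda>C. Nt (f C)) s"
  have ne: "A \<noteq> final_state Y" "B \<noteq> final_state Y" using push.hyps start_in_final_notin[OF gen] by auto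
  have "(Nt (f A) # ?s, [Nt (f B), Nt (f D)] @ ?s) \<in> (derives1 (generator_cfg f Y))\<^sup>*"
    using push.hyps by (intro derives_prod) (auto simp: generator_cfg_def)
  also have "([Nt (f B), Nt (f D)] @ ?s, map Tm \<alpha>) \<in> (derives1 (generator_cfg f Y))\<^sup>*"
    using push.IH[of "D # s"] push.prems ne by simp
  finally show ?case using ne by simp
next
  case (pop C \<alpha> u)
  have "C \<noteq> final_state Y" using pop.hyps start_in_final_notin[OF gen] by auto
  \<comment> \<open>A successful pop forces \<open>C\<close> to be on top of \<open>s\<close>, so
    the sentential form does not change: its first symbol merely turns from stack top into current
    nonterminal.\<close>
  with pop show ?case by (auto split: list.splits if_splits)
qed

lemma derives_imp_walk:
  assumes gen: "is_cf_generator Y" and inj: "inj_on f (nonterminals Y)" and S: "S \<in> nonterminals Y"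
    and deriv: "([Nt (f S)], map Tm \<alpha>) \<in> (derives1 (generator_cfg f Y))\<^sup>*"
  obtains u where "walk Y S \<alpha> u" "(u, []) \<in> mcong (T_gens (nonterminals Y)) (T_rels (nonterminals Y))"
proof -
  let ?N = "nonterminals Y" and ?Z = "final_state Y"
  let ?c = "mcong (T_gens ?N) (T_rels ?N)"
  \<comment> \<open>The languages of walks with trivial label in \<open>T\<close>, indexed by codes;
    they are shown to be closed under the productions. Injectivity of \<open>f\<close> lets a code
    determine its nonterminal.\<close>
  define R where "R n \<beta> \<longleftrightarrow> (\<exists>A\<in>?N. f A = n \<and> (\<exists>u. walk Y A \<beta> u \<and> (u, []) \<in> ?c))" for n \<beta>
  have R_f: "R (f A) \<beta> \<longleftrightarrow> (\<exists>u. walk Y A \<beta> u \<and> (u, []) \<in> ?c)" if "A \<in> ?N" for A \<beta>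
    using that inj by (auto simp: R_def dest: inj_onD)
  have "R n \<beta>" if prod: "(n, w) \<in> cfg_prods (generator_cfg f Y)" and yld: "yields R w \<beta>" for n w \<beta>
  proof -
    consider (letter) A a where "n = f A" "w = [Tm a]" "A \<in> ?N" "a \<in> terminals Y"
        "has_label Y A ?Z (letter_label Y a)"
      | (pair) A B D where "n = f A" "w = [Nt (f B), Nt (f D)]" "A \<in> ?N" "B \<in> ?N" "D \<in> ?N"
        "has_label Y A B (plain_label Y D)"
      using prod unfolding generator_cfg_def by auto
    then show ?thesis
    proof cases
      case letter
      have "walk Y A [a] []" using letter by (intro walk.emit walk.stop)
      moreover have "([], []) \<in> ?c" by (rule mcong.refl) simp
      ultimately show ?thesis using letter yld R_f by auto
    next
      case pair
      obtain \<gamma> \<eta> u v where \<beta>: "\<beta> = \<gamma> @ \<eta>"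
        and u: "walk Y B \<gamma> u" "(u, []) \<in> ?c" and v: "walk Y D \<eta> v" "(v, []) \<in> ?c"
        using yld pair R_f by auto
      \<comment> \<open>The walk from \<open>D\<close> is preceded by the pop of \<open>D\<close>,
        so it can be attached where the walk from \<open>B\<close> ends.\<close>
      have "walk Y ?Z \<eta> (Primed D # v)"
        using walk.pop has_label_primed[OF gen] pair v by metis
      from walk.push[OF pair(3-6) walk_append[OF u(1) this]]
      show ?thesis using mcong_bracket[OF pair(5) u(2) v(2)] R_f pair \<beta> by blast
    qed
  qed
  then have "yields R [Nt (f S)] \<alpha>"
    using derives_yields[OF _ deriv] by blast
  then show thesis using that R_f[OF S] by auto
qed

theorem theorem3:
  fixes Y :: "'a cf_generator"
  assumes "is_cf_generator Y"
  shows "context_free (terminals Y) (generator_lang Y)"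
proof -
  obtain f :: "'a \<Rightarrow> nat" where inj: "inj_on f (nonterminals Y)"
    using finite_imp_inj_to_nat_seg[OF is_cf_generatorD(2)[OF assms]] by blast
  let ?G = "generator_cfg f Y" and ?S = "start_state Y"
  let ?c = "mcong (T_gens (nonterminals Y)) (T_rels (nonterminals Y))"
  have S: "?S \<in> nonterminals Y" "?S \<noteq> final_state Y" using start_in_final_notin[OF assms] by auto
  have "cfg_lang ?G = {\<alpha> \<in> lists (terminals Y). \<exists>u. walk Y ?S \<alpha> u \<and> (u, []) \<in> ?c}"
  proof -
    have "([Nt (f ?S)], map Tm \<alpha>) \<in> (derives1 ?G)\<^sup>*" if "walk Y ?S \<alpha> u" "(u, []) \<in> ?c" for \<alpha> u
      using walk_imp_derives[OF assms that(1), of "[]" f] run_stack_mcong[OF that(2)] S by simp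
    moreover have "\<exists>u. walk Y ?S \<alpha> u \<and> (u, []) \<in> ?c"
      if "([Nt (f ?S)], map Tm \<alpha>) \<in> (derives1 ?G)\<^sup>*" for \<alpha>
      using derives_imp_walk[OF assms inj S(1) that] by blast
    ultimately show ?thesis unfolding cfg_lang_def by (auto simp: generator_cfg_def)
  qed
  also have "\<dots> = generator_lang Y"
  proof -
    have "\<alpha> \<noteq> []" if "walk Y ?S \<alpha> u" "(u, []) \<in> ?c" for \<alpha> u
    proof
      \<comment> \<open>A walk that starts outside the final state has to enter it, and only
        \<open>emit\<close> does so.\<close>
      have "\<alpha> \<noteq> []" if "walk Y A \<alpha> u" "A \<noteq> final_state Y" for A \<alpha> u
        using that start_in_final_notin[OF assms] by (induction rule: walk.induct) auto
      then show "\<alpha> = [] \<Longrightarrow> False" using that S by blast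
    qed
    moreover have "generated Y \<alpha> \<longleftrightarrow> (\<exists>u. walk Y ?S \<alpha> u \<and> (u, []) \<in> ?c)" for \<alpha>
      using generated_imp_walk[OF assms] walk_imp_generated[OF assms] by metis
    ultimately show ?thesis unfolding generator_lang_def by blast
  qed
  finally show ?thesis
    unfolding context_free_def using is_cfg_generator_cfg[OF assms, of f]
    by (auto simp: generator_cfg_def)
qed

end
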